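(* Let $\mathbb{F}$ be an algebraically closed field of characteristic $p>2$, let $\lambda\in\mathbb{F}^p$, and let $L_{p,p}^{\lambda}$ be the restricted model filiform Lie superalgebra. Then $$H^1(L_{p,p}^{\lambda},\mathbb{F})=H^1_*(L_{p,p}^{\lambda},\mathbb{F}),$$ where $\mathbb F$ is the $1$-dimensional trivial module, and the classes of $\{X^1,X^2,Y^1\}$ form a basis.
   Context: $L_{p,p}^\lambda$, for $\lambda=(\lambda_1,\ldots,\lambda_p)\in\mathbb F^p$, is the Lie superalgebra with even basis $X_1,\ldots,X_p$, odd basis $Y_1,\ldots,Y_p$, super-brackets $[X_1,X_i]=X_{i+1}$ ($2\le i\le p-1$), $[X_1,Y_j]=Y_{j+1}$ ($1\le j\le p-1$), all other brackets of basis elements (not determined by super-skew-symmetry) being zero, and with $p$-map on the even part $(\sum_{k=1}^pa_kX_k)^{[p]}=(\sum_{k=1}^pa_k^p\lambda_k)X_p$; it is a restricted Lie superalgebra. $X^1,\ldots,X^p,Y^1,\ldots,Y^p$ denotes the dual basis of $\mathrm{Hom}_{\mathbb F}(L_{p,p}^\lambda,\mathbb F)$. Cohomology in degree $1$ with trivial coefficients, $L=L^\lambda_{p,p}$: $C^1_*(L;\mathbb F)=C^1(L;\mathbb F)=\mathrm{Hom}_{\mathbb F}(L,\mathbb F)$, $C^0_*(L;\mathbb F)=C^0(L;\mathbb F)=\mathbb F$, and $d^0_*=d^0=0$. For $\varphi\in C^1(L;\mathbb F)$: $d^1\varphi(x,y)=-\varphi([x,y])$ for $x,y\in L$, $\mathrm{ind}^1(\varphi)(z)=\varphi(z^{[p]})$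 for $z\in L_{\bar0}$, and $d^1_*(\varphi)=(d^1\varphi,\mathrm{ind}^1(\varphi))$. Then $H^1(L,\mathbb F)=\mathrm{Ker}\,d^1/\mathrm{Im}\,d^0$ and $H^1_*(L,\mathbb F)=\mathrm{Ker}\,d^1_*/\mathrm{Im}\,d^0_*$; since $d^0=d^0_*=0$, both are subspaces of $C^1(L;\mathbb F)$. *)

theory Defs
  imports
    "HOL-Computational_Algebra.Computational_Algebra"
    "HOL-Library.Function_Algebras"
    "HOL-Library.Product_Plus"
begin

datatype basis_index = Even_idx nat | Odd_idx nat

definition basis_indices :: "nat \<Rightarrow> basis_index set" where
  "basis_indices p = Even_idx ` {1..p} \<union> Odd_idx ` {1..p}"

text \<open>
  The vector space with basis \<open>X\<^sub>1,\<dots>,X\<^sub>p,Y\<^sub>1,\<dots>,Y\<^sub>p\<close>, where \<open>p\<close> is the characteristic of the ground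
  field: an element is its family of coordinates. The parameter \<open>\<lambda>\<close> enters only
  through the \<open>p\<close>-map, so it is not part of the type.
\<close>
typedef (overloaded) 'a filiform =
  "{u :: basis_index \<Rightarrow> 'a::field. \<forall>k. k \<notin> basis_indices CHAR('a) \<longrightarrow> u k = 0}"
  morphisms coord Abs_filiform
  by (rule exI[of _ "\<lambda>_. 0"]) simp

setup_lifting type_definition_filiform

instantiation filiform :: (field) ab_group_add
begin
lift_definition zero_filiform :: "'a filiform" is "\<lambda>_. 0" by simp
lift_definition plus_filiform :: "'a filiform \<Rightarrow> 'a filiform \<Rightarrow> 'a filiform"
  is "\<lambda>u v k. u k + v k" by simp
lift_definition minus_filiform :: "'a filiform \<Rightarrow> 'a filiform \<Rightarrow> 'a filiform"
  is "\<lambda>u v k. u k - v k" by simp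
lift_definition uminus_filiform :: "'a filiform \<Rightarrow> 'a filiform"
  is "\<lambda>u k. - u k" by simp
instance by standard (transfer; simp add: algebra_simps fun_eq_iff)+
end

lift_definition scale_L :: "'a::field \<Rightarrow> 'a filiform \<Rightarrow> 'a filiform"
  is "\<lambda>c u k. c * u k" by simp

global_interpretation L: vector_space scale_L
  by standard (transfer; simp add: algebra_simps fun_eq_iff)+

text \<open>The basis vector of a given index; indices outside \<open>{1..p}\<close> yield \<open>0\<close>.\<close>
lift_definition basis_vec :: "basis_index \<Rightarrow> 'a::field filiform"
  is "\<lambda>e k. if k = e \<and> k \<in> basis_indices CHAR('a) then 1 else 0" by simp

abbreviation XX :: "nat \<Rightarrow> 'a::field filiform" where "XX i \<equiv> basis_vec (Even_idx i)"
abbreviation YY :: "nat \<Rightarrow> 'a::field filiform" where "YY j \<equiv> basis_vec (Odd_idx j)"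

text \<open>
  Super-skew-symmetry reads \<open>[y, x] = - (-1)\<^bsup>|x||y|\<^esup> [x, y]\<close>; as \<open>X\<^sub>1\<close> is even, both
  \<open>[X\<^sub>i, X\<^sub>1]\<close> and \<open>[Y\<^sub>j, X\<^sub>1]\<close> get a minus sign.
\<close>
fun basis_bracket :: "basis_index \<Rightarrow> basis_index \<Rightarrow> 'a::field filiform" where
  "basis_bracket (Even_idx i) (Even_idx j) =
     (if i = 1 \<and> j \<in> {2..CHAR('a) - 1} then XX (j + 1)
      else if j = 1 \<and> i \<in> {2..CHAR('a) - 1} then - XX (i + 1)
      else 0)"
| "basis_bracket (Even_idx i) (Odd_idx j) =
     (if i = 1 \<and> j \<in> {1..CHAR('a) - 1} then YY (j + 1) else 0)"
| "basis_bracket (Odd_idx j) (Even_idx i) =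
     (if i = 1 \<and> j \<in> {1..CHAR('a) - 1} then - YY (j + 1) else 0)"
| "basis_bracket (Odd_idx i) (Odd_idx j) = 0"

definition bracket :: "'a::field filiform \<Rightarrow> 'a filiform \<Rightarrow> 'a filiform" where
  "bracket u v =
     (\<Sum>e\<in>basis_indices CHAR('a). \<Sum>f\<in>basis_indices CHAR('a).
        scale_L (coord u e * coord v f) (basis_bracket e f))"

lemma finite_basis_indices: "finite (basis_indices p)"
  by (simp add: basis_indices_def)

lemma bracket_basis_vec:
  assumes "e \<in> basis_indices CHAR('a)" "f \<in> basis_indices CHAR('a)"
  shows "bracket (basis_vec e) (basis_vec f :: 'a::field filiform) = basis_bracket e f"
proof -
  let ?B = "basis_indices CHAR('a)"
  have c: "coord (basis_vec e :: 'a filiform) k = (if k = e then 1 else 0)"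
    if "e \<in> ?B" for e k
    using that by transfer auto
  have "bracket (basis_vec e) (basis_vec f :: 'a filiform) =
      (\<Sum>k\<in>?B. \<Sum>l\<in>?B. if k = e then if l = f then basis_bracket k l else 0 else 0)"
    unfolding bracket_def using assms
    by (intro sum.cong refl) (auto simp: c)
  also have "\<dots> = (\<Sum>k\<in>?B. if k = e then basis_bracket k f else 0)"
    using assms finite_basis_indices by (intro sum.cong refl) (auto simp: sum.delta)
  also have "\<dots> = basis_bracket e f"
    using assms finite_basis_indices by (simp add: sum.delta)
  finally show ?thesis .
qed

definition even_part :: "'a::field filiform set" where
  "even_part = L.span (XX ` {1..CHAR('a)})"

text \<open>
  The parameter \<open>\<lambda> \<in> \<bbbF>\<^sup>p\<close> is a function on \<^typ>\<open>nat\<close> of which only the values on \<open>{1..p}\<close>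
  are used. The \<open>p\<close>-map is meaningful on \<^const>\<open>even_part\<close> only.
\<close>
definition p_map :: "(nat \<Rightarrow> 'a::field) \<Rightarrow> 'a filiform \<Rightarrow> 'a filiform" where
  "p_map lam z =
     scale_L (\<Sum>k=1..CHAR('a). coord z (Even_idx k) ^ CHAR('a) * lam k) (XX CHAR('a))"

definition scale_dual :: "'a::field \<Rightarrow> ('a filiform \<Rightarrow> 'a) \<Rightarrow> 'a filiform \<Rightarrow> 'a" where
  "scale_dual c \<phi> = (\<lambda>x. c * \<phi> x)"

global_interpretation dual: vector_space "scale_dual :: 'a::field \<Rightarrow> _"
  by standard (auto simp: scale_dual_def algebra_simps fun_eq_iff)

text \<open>Dual basis: the coordinate functionals.\<close>
definition X_dual :: "nat \<Rightarrow> 'a::field filiform \<Rightarrow> 'a" where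
  "X_dual i = (\<lambda>u. coord u (Even_idx i))"

definition Y_dual :: "nat \<Rightarrow> 'a::field filiform \<Rightarrow> 'a" where
  "Y_dual j = (\<lambda>u. coord u (Odd_idx j))"

definition C1 :: "('a::field filiform \<Rightarrow> 'a) set" where
  "C1 = {\<phi>. Vector_Spaces.linear scale_L (*) \<phi>}"

definition d1 :: "('a::field filiform \<Rightarrow> 'a) \<Rightarrow> 'a filiform \<Rightarrow> 'a filiform \<Rightarrow> 'a" where
  "d1 \<phi> = (\<lambda>x y. - \<phi> (bracket x y))"

text \<open>A function on \<^const>\<open>even_part\<close>, extended by \<open>0\<close>.\<close>
definition ind1 :: "(nat \<Rightarrow> 'a::field) \<Rightarrow> ('a filiform \<Rightarrow> 'a) \<Rightarrow> 'a filiform \<Rightarrow> 'a" where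
  "ind1 lam \<phi> = (\<lambda>z. if z \<in> even_part then \<phi> (p_map lam z) else 0)"

definition d1_res ::
  "(nat \<Rightarrow> 'a::field) \<Rightarrow> ('a filiform \<Rightarrow> 'a)
     \<Rightarrow> ('a filiform \<Rightarrow> 'a filiform \<Rightarrow> 'a) \<times> ('a filiform \<Rightarrow> 'a)" where
  "d1_res lam \<phi> = (d1 \<phi>, ind1 lam \<phi>)"

text \<open>
  With trivial coefficients the differentials in degree \<open>0\<close> vanish, ordinary and restricted.
  So there are no nonzero coboundaries in degree \<open>1\<close>, the quotients \<open>Ker / Im\<close> are the kernels,
  and the class of a cocycle is the cocycle itself.
\<close>
definition H1 :: "('a::field filiform \<Rightarrow> 'a) set" where
  "H1 = {\<phi> \<in> C1. d1 \<phi> = 0}"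

definition H1_res :: "(nat \<Rightarrow> 'a::field) \<Rightarrow> ('a filiform \<Rightarrow> 'a) set" where
  "H1_res lam = {\<phi> \<in> C1. d1_res lam \<phi> = 0}"

end

(* A linear form is a cocycle iff it vanishes on all brackets of basis vectors, that is, on every
   X_i with i > 2 and every Y_j with j > 1; such forms are the combinations of X^1, X^2, Y^1. As
   p > 2, cocycles vanish on X_p, which spans the values of the p-map, so the condition
   ind^1 = 0 is automatic. *)
theory Submission
  imports Defs
begin

lemma basis_indices_iff [simp]:
  "Even_idx i \<in> basis_indices p \<longleftrightarrow> i \<in> {1..p}"
  "Odd_idx j \<in> basis_indices p \<longleftrightarrow> j \<in> {1..p}"
  by (auto simp: basis_indices_def)

lemma coord_basis_vec:
  "coord (basis_vec e :: 'a::field filiform) k =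
     (if k = e \<and> e \<in> basis_indices CHAR('a) then 1 else 0)"
  by transfer auto

lemma coord_sum: "coord (\<Sum>i\<in>A. f i) k = (\<Sum>i\<in>A. coord (f i) k)"
  by (induction A rule: infinite_finite_induct)
    (simp_all add: zero_filiform.rep_eq plus_filiform.rep_eq)

lemma basis_expansion:
  "u = (\<Sum>e\<in>basis_indices CHAR('a). scale_L (coord u e) (basis_vec e :: 'a::field filiform))"
    (is "u = ?s")
proof -
  have "coord u k = coord ?s k" for k
  proof -
    have "coord ?s k = (\<Sum>e\<in>basis_indices CHAR('a). if k = e then coord u k else 0)"
      unfolding coord_sum
      by (intro sum.cong refl) (auto simp: scale_L.rep_eq coord_basis_vec)
    also have "\<dots> = coord u k"
      \<comment> \<open>For \<open>k\<close> outside \<open>basis_indices\<close> the sum is 0;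
        \<open>coord[of u]\<close> supplies that \<open>coord u k\<close> is 0 there as
        well.\<close>
      using coord[of u] by (auto simp: finite_basis_indices)
    finally show ?thesis by simp
  qed
  then show ?thesis
    by (metis coord_inject ext)
qed

text \<open>The vector space axioms contained in the linearity predicate hold for
  \<open>scale_L\<close> and for the field acting on itself, so only additivity and homogeneity
  remain.\<close>

lemma C1_iff:
  "\<phi> \<in> C1 \<longleftrightarrow>
     (\<forall>u v. \<phi> (u + v) = \<phi> u + \<phi> v) \<and> (\<forall>c u. \<phi> (scale_L c u) = c * \<phi> u)"
  unfolding C1_def
  using L.vector_space_axioms
  by (auto simp: Vector_Spaces.linear_iff vector_space_def algebra_simps)

lemma
  assumes "\<phi> \<in> C1"
  shows C1_scale: "\<phi> (scale_L c u) = c * \<phi> u"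
    and C1_zero: "\<phi> 0 = 0"
    and C1_uminus: "\<phi> (- u) = - \<phi> u"
    and C1_sum: "\<phi> (\<Sum>i\<in>A. f i) = (\<Sum>i\<in>A. \<phi> (f i))"
proof -
  have add: "\<phi> (u + v) = \<phi> u + \<phi> v" for u v
    using assms by (simp add: C1_iff)
  show "\<phi> (scale_L c u) = c * \<phi> u"
    using assms by (simp add: C1_iff)
  show zero: "\<phi> 0 = 0"
    using add[of 0 0] by (metis add_0 add_cancel_right_right)
  show "\<phi> (- u) = - \<phi> u"
    using add[of u "- u"] zero by (simp add: eq_neg_iff_add_eq_0 add.commute)
  show "\<phi> (\<Sum>i\<in>A. f i) = (\<Sum>i\<in>A. \<phi> (f i))"
    by (induction A rule: infinite_finite_induct) (simp_all add: add zero)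
qed

lemma C1_expansion:
  assumes "\<phi> \<in> C1"
  shows "\<phi> u = (\<Sum>e\<in>basis_indices CHAR('a). coord u e * \<phi> (basis_vec e :: 'a::field filiform))"
  by (subst basis_expansion[of u]) (simp add: C1_sum[OF assms] C1_scale[OF assms])

lemma C1_bracket:
  assumes "\<phi> \<in> C1"
  shows "\<phi> (bracket u v :: 'a::field filiform) =
    (\<Sum>e\<in>basis_indices CHAR('a). \<Sum>f\<in>basis_indices CHAR('a).
       coord u e * coord v f * \<phi> (basis_bracket e f))"
  by (simp add: bracket_def C1_sum[OF assms] C1_scale[OF assms])

text \<open>The listed basis vectors are, up to sign, exactly the nonzero brackets of basis vectors,
  and by bilinearity these decide whether the form vanishes on all brackets.\<close>

lemma H1_iff:
  "\<phi> \<in> (H1 :: ('a::field filiform \<Rightarrow> 'a) set) \<longleftrightarrow>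
     \<phi> \<in> C1 \<and> (\<forall>i\<in>{3..CHAR('a)}. \<phi> (XX i) = 0) \<and> (\<forall>j\<in>{2..CHAR('a)}. \<phi> (YY j) = 0)"
    (is "_ \<longleftrightarrow> _ \<and> ?X \<and> ?Y")
proof (intro iffI conjI ballI)
  assume "\<phi> \<in> H1"
  then show C: "\<phi> \<in> C1" by (simp add: H1_def)
  have bracket: "\<phi> (bracket u v) = 0" for u v
  proof -
    have "d1 \<phi> u v = 0"
      using \<open>\<phi> \<in> H1\<close> by (simp add: H1_def)
    then show ?thesis by (simp add: d1_def)
  qed
  show "\<phi> (XX i) = 0" if "i \<in> {3..CHAR('a)}" for i
  proof -
    \<comment> \<open>As \<open>i\<close> is at least 3, \<open>i - 1\<close> is at least 2. The
      even chain starts at \<open>XX 2\<close>, because \<open>XX 1\<close> commutes with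
      itself.\<close>
    have "bracket (XX 1) (XX (i - 1)) = (XX i :: 'a filiform)"
      using that by (subst bracket_basis_vec) auto
    then show ?thesis using bracket by metis
  qed
  show "\<phi> (YY j) = 0" if "j \<in> {2..CHAR('a)}" for j
  proof -
    \<comment> \<open>The odd chain already starts at \<open>YY 1\<close>, so \<open>YY 2\<close> is
      a bracket while \<open>XX 2\<close> is not.\<close>
    have "bracket (XX 1) (YY (j - 1)) = (YY j :: 'a filiform)"
      using that by (subst bracket_basis_vec) auto
    then show ?thesis using bracket by metis
  qed
next
  assume A: "\<phi> \<in> C1 \<and> ?X \<and> ?Y"
  then have C: "\<phi> \<in> C1" by simp
  \<comment> \<open>In each of the four parity cases the value is 0 or, up to sign,
    \<open>XX (j + 1)\<close> with \<open>j\<close> at least 2 or \<open>YY (j + 1)\<close> with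
    \<open>j\<close> at least 1.\<close>
  have "\<phi> (basis_bracket e f) = 0" for e f
    using A
    by (cases "(e, f :: basis_index)" rule: basis_bracket.cases)
      (auto simp: C1_zero[OF C] C1_uminus[OF C])
  then have "\<phi> (bracket u v) = 0" for u v
    by (simp add: C1_bracket[OF C])
  then show "\<phi> \<in> H1"
    using C by (simp add: H1_def d1_def fun_eq_iff)
qed

lemma H1_res_eq_H1:
  assumes "CHAR('a) > 2"
  shows "H1_res lam = (H1 :: ('a::field filiform \<Rightarrow> 'a) set)"
proof -
  have "ind1 lam \<phi> = 0" if "\<phi> \<in> H1" for \<phi> :: "'a filiform \<Rightarrow> 'a"
  proof -
    \<comment> \<open>The bound on the characteristic places the index p in
      \<open>{3..p}\<close>.\<close>
    have "\<phi> \<in> C1" "\<phi> (XX CHAR('a)) = 0"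
      using that assms by (auto simp: H1_iff)
    then show ?thesis
      by (simp add: ind1_def p_map_def C1_scale fun_eq_iff)
  qed
  then show ?thesis
    by (auto simp: H1_def H1_res_def d1_res_def zero_prod_def)
qed

lemma subspace_vanishing: "dual.subspace {\<phi>. \<phi> v = 0}"
  by (simp add: dual.subspace_def scale_dual_def)

lemma subspace_H1: "dual.subspace (H1 :: ('a::field filiform \<Rightarrow> 'a) set)"
  by (simp add: dual.subspace_def H1_iff C1_iff scale_dual_def algebra_simps)

text \<open>Evaluation at \<open>v\<close> is linear in the functional, so its kernel is a subspace;
  it contains \<open>S\<close>, hence the span of \<open>S\<close>.\<close>

lemma not_in_dual_span:
  assumes "\<And>\<psi>. \<psi> \<in> S \<Longrightarrow> \<psi> v = 0" "\<phi> v \<noteq> 0"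
  shows "\<phi> \<notin> dual.span S"
  using dual.span_minimal[OF _ subspace_vanishing, of S v] assms by blast

theorem theorem4p1:
  fixes lam :: "nat \<Rightarrow> 'a::alg_closed_field"
  assumes "CHAR('a) > 2"
  shows "(H1 :: ('a filiform \<Rightarrow> 'a) set) = H1_res lam
    \<and> distinct [X_dual 1, X_dual 2, Y_dual 1 :: 'a filiform \<Rightarrow> 'a]
    \<and> dual.independent {X_dual 1, X_dual 2, Y_dual 1 :: 'a filiform \<Rightarrow> 'a}
    \<and> dual.span {X_dual 1, X_dual 2, Y_dual 1} = (H1 :: ('a filiform \<Rightarrow> 'a) set)"
proof (intro conjI)
  let ?B = "{X_dual 1, X_dual 2, Y_dual 1 :: 'a filiform \<Rightarrow> 'a}"
  \<comment> \<open>An index out of range would make the basis vector 0, and evaluating there would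
    separate nothing.\<close>
  have idx: "Even_idx 1 \<in> basis_indices CHAR('a)" "Even_idx 2 \<in> basis_indices CHAR('a)"
      "Odd_idx 1 \<in> basis_indices CHAR('a)"
    using assms by auto
  note eval = X_dual_def Y_dual_def coord_basis_vec
  \<comment> \<open>Each functional is separated from the span of the later ones by the basis vector
    dual to it; adding them one at a time yields independence.\<close>
  have X1: "X_dual 1 \<notin> dual.span {X_dual 2, Y_dual 1 :: 'a filiform \<Rightarrow> 'a}"
    by (rule not_in_dual_span[where v = "XX 1"]) (use idx in \<open>auto simp: eval\<close>)
  have X2: "X_dual 2 \<notin> dual.span {Y_dual 1 :: 'a filiform \<Rightarrow> 'a}"
    by (rule not_in_dual_span[where v = "XX 2"]) (use idx in \<open>auto simp: eval\<close>)
  have Y1: "Y_dual 1 \<notin> dual.span ({} :: ('a filiform \<Rightarrow> 'a) set)"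
    by (rule not_in_dual_span[where v = "YY 1"]) (use idx in \<open>auto simp: eval\<close>)
  show "H1 = H1_res lam"
    using H1_res_eq_H1[OF assms] by simp
  \<comment> \<open>Equal functionals would put one of them into the span of the later ones.\<close>
  show "distinct [X_dual 1, X_dual 2, Y_dual 1 :: 'a filiform \<Rightarrow> 'a]"
    using X1 X2 dual.span_superset[of "{X_dual 2, Y_dual 1 :: 'a filiform \<Rightarrow> 'a}"]
      dual.span_superset[of "{Y_dual 1 :: 'a filiform \<Rightarrow> 'a}"]
    by auto
  show "dual.independent ?B"
    using X1 X2 Y1 by (intro dual.independent_insertI dual.independent_empty)
  show "dual.span ?B = H1"
  proof
    have "?B \<subseteq> H1"
      by (auto simp: H1_iff C1_iff eval plus_filiform.rep_eq scale_L.rep_eq)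
    then show "dual.span ?B \<subseteq> H1"
      by (rule dual.span_minimal[OF _ subspace_H1])
    show "H1 \<subseteq> dual.span ?B"
    proof
      fix \<phi> :: "'a filiform \<Rightarrow> 'a"
      assume "\<phi> \<in> H1"
      then have C: "\<phi> \<in> C1"
        and X: "\<And>i. i \<in> {3..CHAR('a)} \<Longrightarrow> \<phi> (XX i) = 0"
        and Y: "\<And>j. j \<in> {2..CHAR('a)} \<Longrightarrow> \<phi> (YY j) = 0"
        by (auto simp: H1_iff)
      have vanish: "\<phi> (basis_vec e) = 0"
        if "e \<in> basis_indices CHAR('a) - {Even_idx 1, Even_idx 2, Odd_idx 1}" for e
        using that by (auto simp: basis_indices_def intro!: X Y)
      \<comment> \<open>The coefficients are the values of the form on the three basis vectors where
        it may be nonzero.\<close>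
      have "\<phi> u = (scale_dual (\<phi> (XX 1)) (X_dual 1) + (scale_dual (\<phi> (XX 2)) (X_dual 2) +
          scale_dual (\<phi> (YY 1)) (Y_dual 1))) u" for u
      proof -
        have "\<phi> u = (\<Sum>e\<in>{Even_idx 1, Even_idx 2, Odd_idx 1}. coord u e * \<phi> (basis_vec e))"
          unfolding C1_expansion[OF C, of u]
          using idx vanish by (intro sum.mono_neutral_right finite_basis_indices) auto
        then show ?thesis
          by (simp add: scale_dual_def X_dual_def Y_dual_def mult.commute)
      qed
      then have "\<phi> = scale_dual (\<phi> (XX 1)) (X_dual 1) + (scale_dual (\<phi> (XX 2)) (X_dual 2) +
          scale_dual (\<phi> (YY 1)) (Y_dual 1))"
        by blast
      also have "\<dots> \<in> dual.span ?B"
        by (intro dual.span_add dual.span_scale dual.span_base) simp_all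
      finally show "\<phi> \<in> dual.span ?B" .
    qed
  qed
qed

end
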